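(* Let $\widetilde P_B\in\mathbb{R}^{m\times m}$ and $\widetilde P_A\in\mathbb{R}^{n\times n}$ be any symmetric positive definite matrices and let $M\in\mathbb{R}^{m\times n}$ with $M\ne 0$. Let $Q(\widetilde P_BM\widetilde P_A)$ be any support polar of $\widetilde P_BM\widetilde P_A$. Then $$\big\langle M,\ \widetilde P_B\,Q(\widetilde P_BM\widetilde P_A)\,\widetilde P_A\big\rangle=\|\widetilde P_BM\widetilde P_A\|_*>0 .$$
   Context: $\langle X,Y\rangle=\operatorname{tr}(X^\top Y)$ is the Frobenius inner product, $\|\cdot\|_{\mathrm{op}}$ the spectral norm and $\|\cdot\|_*$ the nuclear norm. A support polar of a matrix $C\in\mathbb{R}^{m\times n}$ is any matrix $Q(C)\in\arg\max_{\|U\|_{\mathrm{op}}\le 1}\langle C,U\rangle$, the maximum being over $U\in\mathbb{R}^{m\times n}$. *)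

theory Defs
  imports "HOL-Analysis.Analysis"
begin

definition frobenius_inner :: "real^'n^'m \<Rightarrow> real^'n^'m \<Rightarrow> real" where
  "frobenius_inner X Y = trace (transpose X ** Y)"

definition spectral_norm :: "real^'n^'m \<Rightarrow> real" where
  "spectral_norm X = onorm ((*v) X)"

definition right_singular_space :: "real^'n^'m \<Rightarrow> real \<Rightarrow> (real^'n) set" where
  "right_singular_space X \<sigma> = {v. (transpose X ** X) *v v = \<sigma>\<^sup>2 *\<^sub>R v}"

definition singular_values :: "real^'n^'m \<Rightarrow> real set" where
  "singular_values X = {\<sigma>. 0 \<le> \<sigma> \<and> (\<exists>v. v \<noteq> 0 \<and> v \<in> right_singular_space X \<sigma>)}"

(* The multiplicity of a singular value is the dimension of its eigenspace; the geometric
   and algebraic multiplicities agree because transpose X ** X is symmetric. The index set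
   is finite by finite_singular_values below. *)
definition nuclear_norm :: "real^'n^'m \<Rightarrow> real" where
  "nuclear_norm X = (\<Sum>\<sigma>\<in>singular_values X. real (dim (right_singular_space X \<sigma>)) * \<sigma>)"

definition support_polar :: "real^'n^'m \<Rightarrow> real^'n^'m \<Rightarrow> bool" where
  "support_polar C Q \<longleftrightarrow> is_arg_max (frobenius_inner C) (\<lambda>U. spectral_norm U \<le> 1) Q"

definition symmetric_positive_definite :: "real^'n^'n \<Rightarrow> bool" where
  "symmetric_positive_definite P \<longleftrightarrow>
     transpose P = P \<and> (\<forall>x. x \<noteq> 0 \<longrightarrow> 0 < x \<bullet> (P *v x))"

lemma finite_singular_values: "finite (singular_values X)"
proof -
  have "\<forall>\<sigma>\<in>singular_values X. \<exists>v. v \<noteq> 0 \<and> v \<in> right_singular_space X \<sigma>"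
    by (simp add: singular_values_def)
  then obtain w where w: "\<And>\<sigma>. \<sigma> \<in> singular_values X \<Longrightarrow> w \<sigma> \<noteq> 0 \<and> w \<sigma> \<in> right_singular_space X \<sigma>"
    by metis
  let ?A = "transpose X ** X"
  have sym: "(?A *v u) \<bullet> v = u \<bullet> (?A *v v)" for u v
    by (simp add: dot_lmul_matrix matrix_transpose_mul flip: vector_transpose_matrix)
  have orth: "w a \<bullet> w b = 0"
    if ab: "a \<in> singular_values X" "b \<in> singular_values X" "a \<noteq> b" for a b
  proof -
    have "a\<^sup>2 * (w a \<bullet> w b) = b\<^sup>2 * (w a \<bullet> w b)"
      using sym[of "w a" "w b"] w[OF ab(1)] w[OF ab(2)] by (simp add: right_singular_space_def)
    moreover have "a\<^sup>2 \<noteq> b\<^sup>2"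
      using ab by (auto simp: singular_values_def power2_eq_iff_nonneg)
    ultimately show ?thesis by simp
  qed
  have "inj_on w (singular_values X)"
    using orth w by (intro inj_onI) (metis inner_eq_zero_iff)
  moreover have "pairwise orthogonal (w ` singular_values X)"
    unfolding pairwise_def orthogonal_def using orth by auto
  then have "finite (w ` singular_values X)"
    by (rule pairwise_orthogonal_imp_finite)
  ultimately show ?thesis
    using finite_imageD by blast
qed

end

theory Submission
  imports Defs
begin

text \<open>Let \<open>C = P\<^sub>B M P\<^sub>A\<close>. In an orthonormal eigenbasis \<open>B\<close> of \<open>C\<^sup>T C\<close> the singular value of \<open>v \<in> B\<close> is
  \<open>\<parallel>C v\<parallel>\<close>, so the nuclear norm is \<open>\<Sum>v\<in>B. \<parallel>C v\<parallel>\<close>, whereas \<open>\<langle>C, U\<rangle> = \<Sum>v\<in>B. C v \<bullet> U v\<close>. By Cauchy--Schwarz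
  the former bounds the latter when \<open>U\<close> is a contraction, with equality for the partial isometry
  sending \<open>v\<close> to \<open>C v / \<parallel>C v\<parallel>\<close>. A support polar therefore attains the nuclear norm, and moving the
  symmetric \<open>P\<^sub>B\<close> and \<open>P\<^sub>A\<close> across the inner product gives the claim.\<close>

section \<open>Spectral theorem on an invariant subspace\<close>

text \<open>The quadratic form \<open>x \<bullet> f x\<close> attains its maximum on the compact
  unit sphere of \<open>S\<close>. At a maximiser \<open>v\<close> the residual
  \<open>f v - \<mu> *\<^sub>R v\<close> is orthogonal to \<open>v\<close>, and it must vanish,
  since otherwise a small move along it would increase the Rayleigh quotient.\<close>

lemma self_adjoint_eigenvector:
  fixes f :: "'a::euclidean_space \<Rightarrow> 'a"
  assumes f: "linear f" and self_adjoint: "\<And>x y. f x \<bullet> y = x \<bullet> f y"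
    and S: "subspace S" "f ` S \<subseteq> S" "S \<noteq> {0}"
  obtains v \<mu> where "v \<in> S" "norm v = 1" "f v = \<mu> *\<^sub>R v"
proof -
  let ?K = "S \<inter> sphere 0 1"
  obtain x where x: "x \<in> S" "x \<noteq> 0"
    using S subspace_0 by blast
  then have "x /\<^sub>R norm x \<in> ?K"
    using S(1) by (auto simp: subspace_mul)
  moreover have "compact ?K"
    using S(1) by (metis closed_Int_compact closed_subspace compact_sphere)
  moreover have "continuous_on ?K (\<lambda>x. x \<bullet> f x)"
    using f by (intro continuous_intros linear_continuous_on_compose[of _ "\<lambda>x. x"]) auto
  ultimately obtain v where v: "v \<in> ?K" and max: "\<And>y. y \<in> ?K \<Longrightarrow> y \<bullet> f y \<le> v \<bullet> f v"
    using continuous_attains_sup[of ?K "\<lambda>x. x \<bullet> f x"] by blast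
  define \<mu> where "\<mu> = v \<bullet> f v"
  have vS: "v \<in> S" and nv: "norm v = 1"
    using v by auto
  \<comment> \<open>Homogeneous form of the maximality, so that perturbations of \<open>v\<close>
    need not be normalised.\<close>
  have bound: "y \<bullet> f y \<le> \<mu> * (y \<bullet> y)" if "y \<in> S" for y
  proof (cases "y = 0")
    case False
    then have "y /\<^sub>R norm y \<in> ?K"
      using S(1) that by (auto simp: subspace_mul)
    from max[OF this] have "(y \<bullet> f y) / (norm y)\<^sup>2 \<le> \<mu>"
      by (simp add: \<mu>_def linear_cmul[OF f] power2_eq_square divide_simps)
    with False show ?thesis
      by (simp add: divide_le_eq dot_square_norm)
  qed simp
  define u where "u = f v - \<mu> *\<^sub>R v"
  have uS: "u \<in> S"
    using S vS unfolding u_def by (intro subspace_diff subspace_mul) auto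
  have uv: "u \<bullet> v = 0"
    using nv by (simp add: u_def \<mu>_def inner_diff_left inner_commute[of "f v"] dot_square_norm)
  have "f v = u + \<mu> *\<^sub>R v"
    by (simp add: u_def)
  with uv have uu: "u \<bullet> f v = u \<bullet> u"
    by (simp add: inner_add_right)
  define c where "c = u \<bullet> f u - \<mu> * (u \<bullet> u)"
  \<comment> \<open>first-order optimality of \<open>v\<close> in the direction \<open>u\<close>\<close>
  have quad: "2 * t * (u \<bullet> u) + t\<^sup>2 * c \<le> 0" for t
  proof -
    have "v + t *\<^sub>R u \<in> S"
      using S(1) uS vS by (simp add: subspace_add subspace_mul)
    from bound[OF this] have "\<mu> + 2 * t * (u \<bullet> f v) + t\<^sup>2 * (u \<bullet> f u) \<le> \<mu> * (1 + t\<^sup>2 * (u \<bullet> u))"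
      using uv nv self_adjoint[of v u]
      by (simp add: linear_add[OF f] linear_cmul[OF f] inner_add_left inner_add_right \<mu>_def
          power2_eq_square inner_commute norm_eq_1 algebra_simps)
    then show ?thesis
      by (simp add: c_def uu algebra_simps)
  qed
  have "u \<bullet> u \<le> 0"
  proof (rule ccontr)
    assume "\<not> u \<bullet> u \<le> 0"
    then have pos: "0 < u \<bullet> u" by linarith
    \<comment> \<open>This choice gives \<open>t * \<bar>c\<bar> < u \<bullet> u\<close>, so the
      quadratic term cannot offset the linear one; the summand 1 covers
      \<open>c = 0\<close>.\<close>
    define t where "t = (u \<bullet> u) / (1 + \<bar>c\<bar>)"
    have t: "0 < t" "t * (1 + \<bar>c\<bar>) = u \<bullet> u"
      using pos by (auto simp: t_def divide_simps)
    have "t * (2 * (u \<bullet> u) + t * c) \<le> 0"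
      using quad[of t] by (simp add: power2_eq_square algebra_simps)
    then have "2 * (u \<bullet> u) + t * c \<le> 0"
      using t(1) by (simp add: mult_le_0_iff)
    moreover have "- (t * c) \<le> t * \<bar>c\<bar>"
      using t(1) by (metis abs_ge_minus_self mult_le_cancel_left_pos mult_minus_right)
    ultimately show False
      using t pos by (simp add: algebra_simps)
  qed
  then have "f v = \<mu> *\<^sub>R v"
    by (simp add: u_def inner_gt_zero_iff flip: not_less)
  with vS nv show thesis by (rule that)
qed

text \<open>Induction on the dimension: split off a unit eigenvector; by self-adjointness its
  orthogonal complement within \<open>S\<close> is again invariant. Working with subspaces keeps the
  induction inside one type.\<close>

lemma self_adjoint_orthonormal_eigenbasis:
  fixes f :: "'a::euclidean_space \<Rightarrow> 'a"
  assumes f: "linear f" and self_adjoint: "\<And>x y. f x \<bullet> y = x \<bullet> f y"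
    and "subspace S" "f ` S \<subseteq> S"
  shows "\<exists>B. finite B \<and> pairwise orthogonal B \<and> span B = S
    \<and> (\<forall>v\<in>B. norm v = 1 \<and> (\<exists>\<mu>. f v = \<mu> *\<^sub>R v))"
  using assms(3,4)
proof (induction "dim S" arbitrary: S rule: less_induct)
  case (less S)
  show ?case
  proof (cases "S = {0}")
    case True
    then show ?thesis by (intro exI[of _ "{}"]) auto
  next
    case False
    with less.prems obtain v \<mu> where v: "v \<in> S" "norm v = 1" "f v = \<mu> *\<^sub>R v"
      using self_adjoint_eigenvector[OF f self_adjoint] by metis
    define T where "T = S \<inter> {x. v \<bullet> x = 0}"
    have T: "subspace T"
      using less.prems(1) by (simp add: T_def subspace_inter subspace_hyperplane)
    have invariant: "f ` T \<subseteq> T"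
    proof -
      have "v \<bullet> f x = 0" if "v \<bullet> x = 0" for x
        using self_adjoint[of v x] v(3) that by simp
      with less.prems(2) show ?thesis by (auto simp: T_def)
    qed
    have "v \<notin> T"
      using v(2) by (auto simp: T_def)
    moreover have "T \<subseteq> S"
      by (simp add: T_def)
    ultimately have "T \<subset> S"
      using v(1) by blast
    then have "dim T < dim S"
      using T less.prems(1) by (metis dim_psubset span_eq_iff)
    from less.hyps[OF this T invariant] obtain B where B: "finite B" "pairwise orthogonal B" "span B = T"
      "\<forall>v\<in>B. norm v = 1 \<and> (\<exists>\<mu>. f v = \<mu> *\<^sub>R v)"
      by blast
    have "orthogonal v b" if "b \<in> B" for b
      using that B(3) span_superset[of B] by (auto simp: T_def orthogonal_def)
    then have "pairwise orthogonal (insert v B)"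
      using B(2) by (auto simp: pairwise_insert orthogonal_commute)
    moreover have "span (insert v B) = S"
    proof
      show "span (insert v B) \<subseteq> S"
        using v(1) B(3) span_superset[of B] less.prems(1)
        by (intro span_minimal) (auto simp: T_def)
      show "S \<subseteq> span (insert v B)"
      proof
        fix x assume "x \<in> S"
        then have "x - (v \<bullet> x) *\<^sub>R v \<in> span B"
          using v(1,2) less.prems(1) unfolding B(3) T_def
          by (auto simp: subspace_diff subspace_mul inner_diff_right dot_square_norm)
        then show "x \<in> span (insert v B)"
          using span_breakdown_eq by blast
      qed
    qed
    ultimately show ?thesis
      using B v by (intro exI[of _ "insert v B"]) auto
  qed
qed

section \<open>Inner products in an orthonormal basis\<close>

lemma inner_orthonormal_basis:
  fixes x y :: "'a::euclidean_space"
  assumes "finite B" "pairwise orthogonal B" "\<And>v. v \<in> B \<Longrightarrow> norm v = 1" "span B = UNIV"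
  shows "x \<bullet> y = (\<Sum>v\<in>B. (x \<bullet> v) * (y \<bullet> v))"
proof -
  have "x \<bullet> y = x \<bullet> (\<Sum>v\<in>B. (y \<bullet> v) *\<^sub>R v)"
    using assms by (subst orthonormal_basis_expand) auto
  then show ?thesis
    by (simp add: inner_sum_right mult.commute)
qed

lemma frobenius_inner_eq_inner: "frobenius_inner X Y = X \<bullet> Y"
  unfolding frobenius_inner_def trace_def transpose_def matrix_matrix_mult_def inner_vec_def
  by simp (rule sum.swap)

text \<open>Parseval's identity applied to each pair of rows, followed by an exchange of the two
  sums.\<close>

lemma matrix_inner_orthonormal_basis:
  fixes X Y :: "real^'n^'m"
  assumes "finite B" "pairwise orthogonal B" "\<And>v. v \<in> B \<Longrightarrow> norm v = 1" "span B = UNIV"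
  shows "X \<bullet> Y = (\<Sum>v\<in>B. (X *v v) \<bullet> (Y *v v))"
proof -
  have "X \<bullet> Y = (\<Sum>i\<in>UNIV. \<Sum>v\<in>B. (X $ i \<bullet> v) * (Y $ i \<bullet> v))"
    unfolding inner_vec_def[of X Y] by (intro sum.cong refl inner_orthonormal_basis[OF assms])
  also have "\<dots> = (\<Sum>v\<in>B. \<Sum>i\<in>UNIV. (X $ i \<bullet> v) * (Y $ i \<bullet> v))"
    by (rule sum.swap)
  finally show ?thesis
    by (simp add: inner_vec_def[of "_ *v _"] matrix_vector_mul_component)
qed

lemma inner_gram: "((transpose X ** X) *v u) \<bullet> v = (X *v u) \<bullet> (X *v v)"
  for X :: "real^'n^'m"
  by (simp add: dot_lmul_matrix flip: matrix_vector_mul_assoc)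

section \<open>Nuclear norm and its dual characterisation\<close>

text \<open>The last assumption only says that \<open>v\<close> is an eigenvector of the Gram
  matrix: for a unit vector the eigenvalue is forced to be the square of
  \<open>norm (C *v v)\<close>. This form displays the singular value of \<open>v\<close>.\<close>

locale right_singular_basis =
  fixes C :: "real^'n^'m" and B :: "(real^'n) set"
  assumes finite: "finite B" and orthogonal: "pairwise orthogonal B"
    and norm: "v \<in> B \<Longrightarrow> norm v = 1" and span: "span B = UNIV"
    and gram: "v \<in> B \<Longrightarrow> (transpose C ** C) *v v = (norm (C *v v))\<^sup>2 *\<^sub>R v"
begin

lemma nonzero: "v \<in> B \<Longrightarrow> v \<noteq> 0"
  using norm by force

lemma images_orthogonal:
  assumes "u \<in> B" "v \<in> B" "u \<noteq> v"
  shows "(C *v u) \<bullet> (C *v v) = 0"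
  using assms orthogonal by (simp add: gram pairwise_def orthogonal_def flip: inner_gram)

lemma right_singular_space_eq_span:
  assumes "0 \<le> \<sigma>"
  shows "right_singular_space C \<sigma> = span {v \<in> B. norm (C *v v) = \<sigma>}" (is "_ = span ?E")
proof
  show "right_singular_space C \<sigma> \<subseteq> span ?E"
  proof
    fix x assume x: "x \<in> right_singular_space C \<sigma>"
    have "(x \<bullet> v) *\<^sub>R v \<in> span ?E" if v: "v \<in> B" for v
    proof (cases "norm (C *v v) = \<sigma>")
      case True
      with v show ?thesis by (simp add: span_base span_mul)
    next
      case False
      \<comment> \<open>Both sides equal \<open>(C *v x) \<bullet> (C *v v)\<close>; distinct
        eigenvalues therefore force the coefficient \<open>x \<bullet> v\<close> to be zero.\<close>
      have "\<sigma>\<^sup>2 * (x \<bullet> v) = (norm (C *v v))\<^sup>2 * (x \<bullet> v)"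
        using x v inner_gram[of C x v] inner_gram[of C v x]
        by (simp add: right_singular_space_def gram inner_commute)
      moreover have "\<sigma>\<^sup>2 \<noteq> (norm (C *v v))\<^sup>2"
        using False assms by (simp add: power2_eq_iff_nonneg)
      ultimately show ?thesis by (simp add: span_zero)
    qed
    then have "(\<Sum>v\<in>B. (x \<bullet> v) *\<^sub>R v) \<in> span ?E"
      by (rule span_sum)
    then show "x \<in> span ?E"
      using orthonormal_basis_expand[of B x] orthogonal norm span finite by simp
  qed
  have "subspace (right_singular_space C \<sigma>)"
    by (auto simp: subspace_def right_singular_space_def matrix_vector_right_distrib
        matrix_vector_mult_scaleR scaleR_add_right)
  then show "span ?E \<subseteq> right_singular_space C \<sigma>"
    by (intro span_minimal) (auto simp: right_singular_space_def gram)
qed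

lemma dim_right_singular_space:
  assumes "0 \<le> \<sigma>"
  shows "dim (right_singular_space C \<sigma>) = card {v \<in> B. norm (C *v v) = \<sigma>}" (is "_ = card ?E")
proof -
  have "independent ?E"
    using orthogonal nonzero by (intro pairwise_orthogonal_independent) (auto simp: pairwise_def)
  then show ?thesis
    using assms by (simp add: right_singular_space_eq_span dim_eq_card_independent)
qed

lemma singular_values_eq: "singular_values C = (\<lambda>v. norm (C *v v)) ` B"
proof
  show "singular_values C \<subseteq> (\<lambda>v. norm (C *v v)) ` B"
  proof
    fix \<sigma> assume "\<sigma> \<in> singular_values C"
    then obtain v where "0 \<le> \<sigma>" "v \<noteq> 0" "v \<in> right_singular_space C \<sigma>"
      by (auto simp: singular_values_def)
    \<comment> \<open>An empty fibre would make the eigenspace trivial, contrary to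
      \<open>v \<noteq> 0\<close>.\<close>
    then have "{v \<in> B. norm (C *v v) = \<sigma>} \<noteq> {}"
      by (metis right_singular_space_eq_span span_empty singletonD)
    then show "\<sigma> \<in> (\<lambda>v. norm (C *v v)) ` B" by blast
  qed
  show "(\<lambda>v. norm (C *v v)) ` B \<subseteq> singular_values C"
    using nonzero gram by (auto simp: singular_values_def right_singular_space_def)
qed

text \<open>Grouping \<open>B\<close> by the value of \<open>norm (C *v v)\<close>, the fibre over a
  singular value has as many elements as its multiplicity.\<close>

lemma nuclear_norm_eq: "nuclear_norm C = (\<Sum>v\<in>B. norm (C *v v))"
proof -
  have "nuclear_norm C = (\<Sum>\<sigma>\<in>singular_values C. \<Sum>v\<in>{v \<in> B. norm (C *v v) = \<sigma>}. norm (C *v v))"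
    unfolding nuclear_norm_def
    by (rule sum.cong) (auto simp: dim_right_singular_space singular_values_def)
  also have "\<dots> = (\<Sum>v\<in>B. norm (C *v v))"
    using finite by (intro sum.group) (auto simp: singular_values_eq)
  finally show ?thesis .
qed

lemma inner_le_nuclear_norm:
  assumes "spectral_norm U \<le> 1"
  shows "frobenius_inner C U \<le> nuclear_norm C"
proof -
  have "(C *v v) \<bullet> (U *v v) \<le> norm (C *v v)" if "v \<in> B" for v
  proof -
    have "norm (U *v v) \<le> 1"
      using onorm[OF matrix_vector_mul_bounded_linear, of U v] norm[OF that] assms
      by (simp add: spectral_norm_def)
    then have "norm (C *v v) * norm (U *v v) \<le> norm (C *v v)"
      by (simp add: mult_left_le)
    then show ?thesis
      using norm_cauchy_schwarz order_trans by blast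
  qed
  then show ?thesis
    using matrix_inner_orthonormal_basis[OF finite orthogonal norm span, of C U]
    by (simp add: frobenius_inner_eq_inner nuclear_norm_eq sum_mono)
qed

lemma nuclear_norm_attained:
  obtains U where "spectral_norm U \<le> 1" "frobenius_inner C U = nuclear_norm C"
proof -
  \<comment> \<open>\<open>w v = 0\<close> when \<open>C *v v = 0\<close>, as then \<open>sgn 0 = 0\<close>\<close>
  define w where "w v = sgn (C *v v)" for v
  define g where "g x = (\<Sum>v\<in>B. (x \<bullet> v) *\<^sub>R w v)" for x
  have "linear g"
    by (rule linearI) (auto simp: g_def inner_add_left scaleR_add_left sum.distrib scaleR_sum_right)
  then have U: "matrix g *v x = g x" for x
    by simp
  have w: "w u \<bullet> w v = 0" if "u \<in> B" "v \<in> B" "u \<noteq> v" for u v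
    using images_orthogonal[OF that] by (simp add: w_def sgn_div_norm)
  have contraction: "norm (g x) \<le> 1 * norm x" for x
  proof -
    \<comment> \<open>Pythagoras applies because the images under \<open>C\<close> of distinct basis
      vectors are orthogonal.\<close>
    have "(norm (g x))\<^sup>2 = (\<Sum>v\<in>B. (norm ((x \<bullet> v) *\<^sub>R w v))\<^sup>2)"
      unfolding g_def using finite w
      by (intro norm_sum_Pythagorean) (auto simp: pairwise_def orthogonal_def)
    \<comment> \<open>Only an inequality, since \<open>w v\<close> is zero rather than a unit vector
      on the kernel of \<open>C\<close>.\<close>
    also have "\<dots> \<le> (\<Sum>v\<in>B. (x \<bullet> v) * (x \<bullet> v))"
      by (intro sum_mono) (auto simp: w_def norm_sgn power2_eq_square)
    also have "\<dots> = (norm x)\<^sup>2"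
      using inner_orthonormal_basis[OF finite orthogonal norm span, of x x]
      by (simp add: power2_norm_eq_inner)
    finally show ?thesis
      by (simp add: power2_le_iff_abs_le)
  qed
  then have "spectral_norm (matrix g) \<le> 1"
    unfolding spectral_norm_def by (intro onorm_bound) (auto simp: U)
  moreover have "frobenius_inner C (matrix g) = nuclear_norm C"
  proof -
    have "g v = w v" if v: "v \<in> B" for v
    proof -
      have "g v = (\<Sum>u\<in>B. if u = v then w v else 0)"
        unfolding g_def using v orthogonal norm
        by (intro sum.cong) (auto simp: dot_square_norm pairwise_def orthogonal_def)
      with v finite show ?thesis by simp
    qed
    moreover have "(C *v v) \<bullet> w v = norm (C *v v)" for v
      by (cases "C *v v = 0") (auto simp: w_def sgn_div_norm dot_square_norm power2_eq_square)
    ultimately show ?thesis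
      using matrix_inner_orthonormal_basis[OF finite orthogonal norm span, of C "matrix g"]
      by (simp add: frobenius_inner_eq_inner nuclear_norm_eq U)
  qed
  ultimately show thesis by (rule that)
qed

end

section \<open>Consequences for arbitrary matrices\<close>

lemma right_singular_basis_exists:
  fixes C :: "real^'n^'m"
  obtains B where "right_singular_basis C B"
proof -
  let ?f = "(*v) (transpose C ** C)"
  obtain B where B: "finite B" "pairwise orthogonal B" "span B = UNIV"
    "\<And>v. v \<in> B \<Longrightarrow> norm v = 1" "\<And>v. v \<in> B \<Longrightarrow> \<exists>\<mu>. ?f v = \<mu> *\<^sub>R v"
    using self_adjoint_orthonormal_eigenbasis[of ?f UNIV] inner_gram[of C]
    by (auto simp: inner_commute)
  have "?f v = (norm (C *v v))\<^sup>2 *\<^sub>R v" if "v \<in> B" for v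
  proof -
    obtain \<mu> where \<mu>: "?f v = \<mu> *\<^sub>R v"
      using B(5) \<open>v \<in> B\<close> by blast
    \<comment> \<open>Pairing the eigenvector equation with the unit vector \<open>v\<close>
      identifies the eigenvalue.\<close>
    then have "\<mu> = (norm (C *v v))\<^sup>2"
      using inner_gram[of C v v] B(4)[OF \<open>v \<in> B\<close>] by (simp add: dot_square_norm)
    with \<mu> show ?thesis by simp
  qed
  with B have "right_singular_basis C B"
    by unfold_locales auto
  then show thesis by (rule that)
qed

text \<open>Some term of the basis expansion of \<open>C \<bullet> C\<close> is nonzero, which makes
  one summand of the nuclear norm positive.\<close>

lemma nuclear_norm_pos:
  fixes C :: "real^'n^'m"
  assumes "C \<noteq> 0"
  shows "0 < nuclear_norm C"
proof -
  obtain B where "right_singular_basis C B"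
    by (rule right_singular_basis_exists)
  then interpret right_singular_basis C B .
  have "C \<bullet> C \<noteq> 0"
    using assms by simp
  then obtain v where "v \<in> B" "C *v v \<noteq> 0"
    using matrix_inner_orthonormal_basis[OF finite orthogonal norm span, of C C]
    by (auto elim: sum.not_neutral_contains_not_neutral)
  then show ?thesis
    unfolding nuclear_norm_eq using finite by (intro sum_pos2) auto
qed

lemma support_polar_attains_nuclear_norm:
  assumes "support_polar C Q"
  shows "frobenius_inner C Q = nuclear_norm C"
proof -
  obtain B where "right_singular_basis C B"
    by (rule right_singular_basis_exists)
  then interpret right_singular_basis C B .
  obtain U where "spectral_norm U \<le> 1" "frobenius_inner C U = nuclear_norm C"
    by (rule nuclear_norm_attained)
  with assms inner_le_nuclear_norm[of Q] show ?thesis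
    unfolding support_polar_def is_arg_max_def by force
qed

section \<open>Two-sided multiplication by positive definite matrices\<close>

text \<open>Cyclicity of the trace moves \<open>transpose R\<close> from the front of the product to
  its end.\<close>

lemma inner_matrix_mult_transpose:
  fixes X :: "real^'n^'m" and L :: "real^'m^'k" and R :: "real^'l^'n"
  shows "(L ** X ** R) \<bullet> Y = X \<bullet> (transpose L ** Y ** transpose R)"
proof -
  have "trace (transpose R ** (transpose X ** transpose L ** Y))
      = trace ((transpose X ** transpose L ** Y) ** transpose R)"
    by (rule trace_mul_sym)
  then show ?thesis
    unfolding frobenius_inner_eq_inner[symmetric] frobenius_inner_def
    by (simp add: matrix_transpose_mul matrix_mul_assoc)
qed

lemma symmetric_positive_definite_imp_inj:
  assumes "symmetric_positive_definite P"
  shows "inj ((*v) P)"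
  using assms
  by (intro Real_Vector_Spaces.linear_injective_0[THEN iffD2] allI impI)
    (auto simp: symmetric_positive_definite_def)

text \<open>Since \<open>R\<close> is surjective and \<open>L\<close> injective, a vanishing product
  would make \<open>M\<close> vanish on every vector.\<close>

lemma symmetric_positive_definite_mult_nonzero:
  fixes L :: "real^'m^'m" and R :: "real^'n^'n" and M :: "real^'n^'m"
  assumes L: "symmetric_positive_definite L" and R: "symmetric_positive_definite R" and "M \<noteq> 0"
  shows "L ** M ** R \<noteq> 0"
proof
  assume zero: "L ** M ** R = 0"
  have "M *v x = 0" for x
  proof -
    have "surj ((*v) R)"
      using symmetric_positive_definite_imp_inj[OF R]
      by (simp add: linear_injective_imp_surjective)
    then obtain y where y: "x = R *v y"
      by (metis surjD)
    have "L *v (M *v x) = L *v 0"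
      using zero by (simp add: y matrix_vector_mul_assoc matrix_mul_assoc)
    then show ?thesis
      using symmetric_positive_definite_imp_inj[OF L] by (simp only: inj_eq)
  qed
  then have "M = 0"
    by (simp add: matrix_eq)
  with \<open>M \<noteq> 0\<close> show False ..
qed

theorem corollary2:
  fixes P\<^sub>B :: "real^'m^'m" and P\<^sub>A :: "real^'n^'n" and M Q :: "real^'n^'m"
  assumes "symmetric_positive_definite P\<^sub>B"
    and "symmetric_positive_definite P\<^sub>A"
    and "M \<noteq> 0"
    and "support_polar (P\<^sub>B ** M ** P\<^sub>A) Q"
  shows "frobenius_inner M (P\<^sub>B ** Q ** P\<^sub>A) = nuclear_norm (P\<^sub>B ** M ** P\<^sub>A)
         \<and> 0 < nuclear_norm (P\<^sub>B ** M ** P\<^sub>A)"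
proof
  have "frobenius_inner M (P\<^sub>B ** Q ** P\<^sub>A) = frobenius_inner (P\<^sub>B ** M ** P\<^sub>A) Q"
    using assms(1,2)
    by (simp add: frobenius_inner_eq_inner inner_matrix_mult_transpose symmetric_positive_definite_def)
  also have "\<dots> = nuclear_norm (P\<^sub>B ** M ** P\<^sub>A)"
    using assms(4) by (rule support_polar_attains_nuclear_norm)
  finally show "frobenius_inner M (P\<^sub>B ** Q ** P\<^sub>A) = nuclear_norm (P\<^sub>B ** M ** P\<^sub>A)" .
  show "0 < nuclear_norm (P\<^sub>B ** M ** P\<^sub>A)"
    using assms(1-3) by (intro nuclear_norm_pos symmetric_positive_definite_mult_nonzero)
qed

end
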